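(* Let $d\ge 0$ be an integer, and for non-negative integers $a,b,c$ let $W(d;a,b,c)$ be the weight space of weight $(a,b,c)$ in the space of homogeneous polynomials of degree $d$ in $\mathbb{C}[x_{ijk}: i,j,k\in\{0,1\}]$. (1) $\dim W(d;0,0,0)$ equals $\frac{1}{384}(d+4)^2(d^2+8d+24)$ if $d\equiv 0\pmod 4$, and $\frac{1}{384}(d+2)(d+6)(d^2+8d+28)$ if $d\equiv 2\pmod 4$. (2) Each of $\dim W(d;2,0,0)$, $\dim W(d;0,2,0)$, $\dim W(d;0,0,2)$ equals $\frac{1}{384}d(d+4)^2(d+8)$ if $d\equiv 0\pmod 4$, and $\frac{1}{384}(d+2)(d+6)(d^2+8d+4)$ if $d\equiv 2\pmod 4$. (3) Each of $\dim W(d;2,2,0)$, $\dim W(d;2,0,2)$, $\dim W(d;0,2,2)$ equals $\frac{1}{384}d(d+4)(d^2+12d+8)$ if $d\equiv 0\pmod 4$, and $\frac{1}{384}(d+2)(d^3+14d^2+28d-24)$ if $d\equiv 2\pmod 4$. (4) $\dim W(d;2,2,2)$ equals $\frac{1}{384}d(d^3+16d^2+32d+32)$ if $d\equiv 0\pmod 4$, and $\frac{1}{384}(d+2)(d^3+14d^2+4d+24)$ if $d\equiv 2\pmod 4$. In all of these cases the dimension is $0$ if $d$ is odd.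
   Context: Let $P_d$ be the space of homogeneous polynomials of degree $d$ in $\mathbb{C}[x_{ijk}: i,j,k\in\{0,1\}]$. Let $H_1,H_2,H_3$ be the derivations of this polynomial algebra determined by $H_1\cdot x_{ijk}=(-1)^i x_{ijk}$, $H_2\cdot x_{ijk}=(-1)^j x_{ijk}$, $H_3\cdot x_{ijk}=(-1)^k x_{ijk}$. The weight space $W(d;a,b,c)$ is the subspace of $P_d$ spanned by the monomials having eigenvalues $a,b,c$ for $H_1,H_2,H_3$ respectively. Explicitly, it is spanned by the monomials $\prod_{i,j,k}x_{ijk}^{e_{ijk}}$ with non-negative integer exponents satisfying $\sum_{i,j,k}e_{ijk}=d$, $\sum_{j,k}e_{0jk}-\sum_{j,k}e_{1jk}=a$, $\sum_{i,k}e_{i0k}-\sum_{i,k}e_{i1k}=b$, $\sum_{i,j}e_{ij0}-\sum_{i,j}e_{ij1}=c$; so $\dim W(d;a,b,c)$ is the number of $2\times2\times2$ arrays $(e_{ijk})$ of non-negative integers satisfying these four equations. *)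

theory Defs
  imports Complex_Main "HOL-Library.Poly_Mapping"
begin

text \<open>
  The index set $\{0,1\}$ is represented by \<^typ>\<open>bool\<close>, with \<^const>\<open>False\<close> for $0$ and
  \<^const>\<open>True\<close> for $1$. A polynomial maps each exponent array to its coefficient;
  multiplication is the convolution product of \<^typ>\<open>_ \<Rightarrow>\<^sub>0 _\<close>.
\<close>

type_synonym idx = "bool \<times> bool \<times> bool"
type_synonym expo = "idx \<Rightarrow>\<^sub>0 nat"
type_synonym cpoly = "expo \<Rightarrow>\<^sub>0 complex"

definition const :: "complex \<Rightarrow> cpoly" where
  "const c = Poly_Mapping.single 0 c"

definition scale :: "complex \<Rightarrow> cpoly \<Rightarrow> cpoly" where
  "scale c p = const c * p"

definition X :: "idx \<Rightarrow> cpoly" where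
  "X v = Poly_Mapping.single (Poly_Mapping.single v 1) 1"

definition monomial :: "expo \<Rightarrow> cpoly" where
  "monomial e = (\<Prod>v\<in>UNIV. X v ^ poly_mapping.lookup e v)"

interpretation cpoly: vector_space scale
  by unfold_locales
    (simp_all add: scale_def const_def algebra_simps single_add mult_single
      flip: mult.assoc)

definition homogeneous_polys :: "nat \<Rightarrow> cpoly set" where
  "homogeneous_polys d = {p. \<forall>e\<in>Poly_Mapping.keys p. (\<Sum>v\<in>UNIV. poly_mapping.lookup e v) = d}"

definition derivation :: "(cpoly \<Rightarrow> cpoly) \<Rightarrow> bool" where
  "derivation D \<longleftrightarrow> Vector_Spaces.linear scale scale D \<and> (\<forall>p q. D (p * q) = D p * q + p * D q)"

text \<open>
  The description below determines a unique derivation: see the lemma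
  \<open>ex1_diag_derivation\<close>.
\<close>

definition diag_derivation :: "(idx \<Rightarrow> complex) \<Rightarrow> cpoly \<Rightarrow> cpoly" where
  "diag_derivation \<epsilon> = (THE D. derivation D \<and> (\<forall>v. D (X v) = scale (\<epsilon> v) (X v)))"

definition H1 :: "cpoly \<Rightarrow> cpoly" where
  "H1 = diag_derivation (\<lambda>(i, j, k). (-1) ^ of_bool i)"

definition H2 :: "cpoly \<Rightarrow> cpoly" where
  "H2 = diag_derivation (\<lambda>(i, j, k). (-1) ^ of_bool j)"

definition H3 :: "cpoly \<Rightarrow> cpoly" where
  "H3 = diag_derivation (\<lambda>(i, j, k). (-1) ^ of_bool k)"

definition W :: "nat \<Rightarrow> nat \<Rightarrow> nat \<Rightarrow> nat \<Rightarrow> cpoly set" where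
  "W d a b c = cpoly.span {m \<in> range monomial. m \<in> homogeneous_polys d \<and>
     H1 m = scale (of_nat a) m \<and> H2 m = scale (of_nat b) m \<and> H3 m = scale (of_nat c) m}"

lemma monomial_eq_single: "monomial e = Poly_Mapping.single e 1"
proof -
  have pow: "X v ^ n = Poly_Mapping.single (Poly_Mapping.single v n) 1" for v n
    by (induction n) (simp_all add: X_def mult_single flip: single_add)
  have prod: "(\<Prod>v\<in>A. Poly_Mapping.single (f v) (1::complex)) = Poly_Mapping.single (\<Sum>v\<in>A. f v) 1"
    if "finite A" for A :: "idx set" and f :: "idx \<Rightarrow> expo"
    using that by (induction A) (simp_all add: mult_single)
  have "(\<Sum>v\<in>UNIV. Poly_Mapping.single v (poly_mapping.lookup e v)) = e"
    by (rule poly_mapping_eqI) (simp add: lookup_sum lookup_single when_def)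
  then show ?thesis by (simp add: monomial_def pow prod)
qed

lemma lookup_scale: "poly_mapping.lookup (scale c p) e = c * poly_mapping.lookup p e"
  unfolding scale_def const_def mult_map_scale_conv_mult[symmetric]
  by (simp add: map.rep_eq when_def)

lemma cpoly_induct [case_names zero add]:
  assumes "P 0" and "\<And>e c q. P q \<Longrightarrow> P (scale c (monomial e) + q)"
  shows "P (p :: cpoly)"
proof -
  have p: "p = (\<Sum>e\<in>Poly_Mapping.keys p. scale (poly_mapping.lookup p e) (monomial e))"
    by (rule poly_mapping_eqI)
      (simp add: lookup_sum lookup_scale monomial_eq_single lookup_single when_def in_keys_iff if_distrib cong: if_cong)
  have "P (\<Sum>e\<in>A. scale (f e) (monomial e))" if "finite A" for A f
    using that by (induction A) (simp_all add: assms)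
  then show ?thesis by (subst p) simp
qed

lemma derivation_unique:
  assumes D: "derivation D" and E: "derivation E" and eq: "\<And>v. D (X v) = E (X v)"
  shows "D = E"
proof
  fix p
  interpret D: Vector_Spaces.linear scale scale D using D by (simp add: derivation_def)
  interpret E: Vector_Spaces.linear scale scale E using E by (simp add: derivation_def)
  have DL: "D (p * q) = D p * q + p * D q" for p q using D by (simp add: derivation_def)
  have EL: "E (p * q) = E p * q + p * E q" for p q using E by (simp add: derivation_def)
  have one: "D 1 = E 1" using DL[of 1 1] EL[of 1 1] by simp
  have pow: "D (X v ^ n) = E (X v ^ n)" for v n
    by (induction n) (simp_all add: one DL EL eq)
  have "D (\<Prod>v\<in>A. X v ^ f v) = E (\<Prod>v\<in>A. X v ^ f v)" if "finite A" for A and f :: "idx \<Rightarrow> nat"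
    using that by (induction A) (simp_all add: one DL EL pow)
  then have mono: "D (monomial e) = E (monomial e)" for e by (simp add: monomial_def)
  show "D p = E p"
    by (induction p rule: cpoly_induct) (simp_all add: D.add E.add D.scale E.scale mono)
qed

lemma ex_diag_derivation:
  "\<exists>D. derivation D \<and> (\<forall>e. D (monomial e) = scale (\<Sum>v\<in>UNIV. \<epsilon> v * of_nat (poly_mapping.lookup e v)) (monomial e))"
proof -
  define w where "w e = (\<Sum>v\<in>UNIV. \<epsilon> v * of_nat (poly_mapping.lookup e v))" for e :: expo
  define D :: "cpoly \<Rightarrow> cpoly" where "D = Poly_Mapping.mapp (\<lambda>e c. w e * c)"
  have lookup_D: "poly_mapping.lookup (D p) e = w e * poly_mapping.lookup p e" for p e
    by (simp add: D_def lookup_mapp when_def in_keys_iff)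
  have lin: "Vector_Spaces.linear scale scale D"
    by unfold_locales
      (rule poly_mapping_eqI, simp add: lookup_D lookup_add lookup_scale algebra_simps)+
  interpret D: Vector_Spaces.linear scale scale D by (rule lin)
  have mono: "D (monomial e) = scale (w e) (monomial e)" for e
    by (rule poly_mapping_eqI)
      (simp add: lookup_D lookup_scale monomial_eq_single lookup_single when_def)
  have w_add: "w (e + f) = w e + w f" for e f
    by (simp add: w_def lookup_add algebra_simps sum.distrib)
  have mult: "monomial e * monomial f = monomial (e + f)" for e f
    by (simp add: monomial_eq_single mult_single)
  have sl: "scale c p * q = scale c (p * q)" and sr: "p * scale c q = scale c (p * q)" for c p q
    by (simp_all add: scale_def algebra_simps)
  have mm: "D (monomial e * monomial f) = D (monomial e) * monomial f + monomial e * D (monomial f)" for e f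
    by (simp add: mult mono w_add sl sr cpoly.scale_left_distrib)
  have mp: "D (monomial e * q) = D (monomial e) * q + monomial e * D q" for e q
    by (induction q rule: cpoly_induct)
      (simp_all add: D.zero D.add D.scale sl sr mm cpoly.scale_right_distrib distrib_left)
  have "D (p * q) = D p * q + p * D q" for p q
    by (induction p rule: cpoly_induct)
      (simp_all add: D.zero D.add D.scale sl sr mp cpoly.scale_right_distrib distrib_right)
  then show ?thesis using lin mono unfolding derivation_def w_def by blast
qed

lemma X_eq_monomial: "X v = monomial (Poly_Mapping.single v 1)"
  by (simp add: X_def monomial_eq_single)

lemma ex1_diag_derivation:
  "\<exists>!D. derivation D \<and> (\<forall>v. D (X v) = scale (\<epsilon> v) (X v))"
proof -
  obtain D where D: "derivation D"
    "\<And>e. D (monomial e) = scale (\<Sum>v\<in>UNIV. \<epsilon> v * of_nat (poly_mapping.lookup e v)) (monomial e)"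
    using ex_diag_derivation[of \<epsilon>] by blast
  have s: "(\<Sum>u\<in>UNIV. \<epsilon> u * of_nat (poly_mapping.lookup (Poly_Mapping.single v 1) u)) = \<epsilon> v" for v
    by (simp add: lookup_single when_def if_distrib cong: if_cong)
  have "\<forall>v. D (X v) = scale (\<epsilon> v) (X v)"
    by (simp only: X_eq_monomial D(2) s simp_thms)
  with D(1) show ?thesis
    by (intro ex1I[of _ D]) (auto intro: derivation_unique)
qed

lemma diag_derivation_monomial:
  "diag_derivation \<epsilon> (monomial e) = scale (\<Sum>v\<in>UNIV. \<epsilon> v * of_nat (poly_mapping.lookup e v)) (monomial e)"
proof -
  obtain D where D: "derivation D"
    "\<And>e. D (monomial e) = scale (\<Sum>v\<in>UNIV. \<epsilon> v * of_nat (poly_mapping.lookup e v)) (monomial e)"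
    using ex_diag_derivation[of \<epsilon>] by blast
  have s: "(\<Sum>u\<in>UNIV. \<epsilon> u * of_nat (poly_mapping.lookup (Poly_Mapping.single v 1) u)) = \<epsilon> v" for v
    by (simp add: lookup_single when_def if_distrib cong: if_cong)
  have "D (X v) = scale (\<epsilon> v) (X v)" for v
    by (simp only: X_eq_monomial D(2) s)
  moreover have "derivation (diag_derivation \<epsilon>) \<and> (\<forall>v. diag_derivation \<epsilon> (X v) = scale (\<epsilon> v) (X v))"
    unfolding diag_derivation_def by (rule theI'[OF ex1_diag_derivation])
  ultimately have "diag_derivation \<epsilon> = D"
    using D(1) by (intro derivation_unique) auto
  then show ?thesis by (simp add: D(2))
qed

lemma W_explicit:
  "W d a b c = cpoly.span (monomial ` {e.
      (\<Sum>v\<in>UNIV. poly_mapping.lookup e v) = d \<and>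
      (\<Sum>(i, j, k)\<in>UNIV. (-1) ^ of_bool i * int (poly_mapping.lookup e (i, j, k))) = int a \<and>
      (\<Sum>(i, j, k)\<in>UNIV. (-1) ^ of_bool j * int (poly_mapping.lookup e (i, j, k))) = int b \<and>
      (\<Sum>(i, j, k)\<in>UNIV. (-1) ^ of_bool k * int (poly_mapping.lookup e (i, j, k))) = int c})"
proof -
  have eig: "scale s (monomial e) = scale t (monomial e) \<longleftrightarrow> s = t" for s t e
  proof -
    have "poly_mapping.lookup (monomial e) e = 1"
      by (simp add: monomial_eq_single)
    then have "monomial e \<noteq> 0" by (metis lookup_zero zero_neq_one)
    then show ?thesis using cpoly.scale_cancel_right by blast
  qed
  have cast: "complex_of_int z = of_nat n \<longleftrightarrow> z = int n" for z n
    by (metis of_int_eq_iff of_int_of_nat_eq)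
  have conv: "(\<Sum>v\<in>UNIV. \<epsilon> v * complex_of_nat (poly_mapping.lookup e v)) = of_nat n
      \<longleftrightarrow> (\<Sum>v\<in>UNIV. s v * int (poly_mapping.lookup e v)) = int n"
    if "\<And>v. \<epsilon> v = of_int (s v)" for \<epsilon> and s :: "idx \<Rightarrow> int" and e n
  proof -
    have "(\<Sum>v\<in>UNIV. \<epsilon> v * complex_of_nat (poly_mapping.lookup e v))
        = of_int (\<Sum>v\<in>UNIV. s v * int (poly_mapping.lookup e v))"
      unfolding that of_int_sum of_int_mult of_int_of_nat_eq by (rule refl)
    then show ?thesis by (simp only: cast)
  qed
  have conv1: "(\<Sum>v\<in>UNIV. (case v of (i, j, k) \<Rightarrow> (-1) ^ of_bool i) * complex_of_nat (poly_mapping.lookup e v)) = of_nat n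
      \<longleftrightarrow> (\<Sum>(i, j, k)\<in>UNIV. (-1) ^ of_bool i * int (poly_mapping.lookup e (i, j, k))) = int n" for e :: expo and n
    using conv[of "\<lambda>(i, j, k). (-1) ^ of_bool i" "\<lambda>(i, j, k). (-1) ^ of_bool i" e n]
    by (simp add: case_prod_unfold)
  have conv2: "(\<Sum>v\<in>UNIV. (case v of (i, j, k) \<Rightarrow> (-1) ^ of_bool j) * complex_of_nat (poly_mapping.lookup e v)) = of_nat n
      \<longleftrightarrow> (\<Sum>(i, j, k)\<in>UNIV. (-1) ^ of_bool j * int (poly_mapping.lookup e (i, j, k))) = int n" for e :: expo and n
    using conv[of "\<lambda>(i, j, k). (-1) ^ of_bool j" "\<lambda>(i, j, k). (-1) ^ of_bool j" e n]
    by (simp add: case_prod_unfold)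
  have conv3: "(\<Sum>v\<in>UNIV. (case v of (i, j, k) \<Rightarrow> (-1) ^ of_bool k) * complex_of_nat (poly_mapping.lookup e v)) = of_nat n
      \<longleftrightarrow> (\<Sum>(i, j, k)\<in>UNIV. (-1) ^ of_bool k * int (poly_mapping.lookup e (i, j, k))) = int n" for e :: expo and n
    using conv[of "\<lambda>(i, j, k). (-1) ^ of_bool k" "\<lambda>(i, j, k). (-1) ^ of_bool k" e n]
    by (simp add: case_prod_unfold)
  have "{m \<in> range monomial. m \<in> homogeneous_polys d \<and>
     H1 m = scale (of_nat a) m \<and> H2 m = scale (of_nat b) m \<and> H3 m = scale (of_nat c) m} =
     monomial ` {e. monomial e \<in> homogeneous_polys d \<and>
       H1 (monomial e) = scale (of_nat a) (monomial e) \<and>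
       H2 (monomial e) = scale (of_nat b) (monomial e) \<and>
       H3 (monomial e) = scale (of_nat c) (monomial e)}"
    by blast
  moreover have "monomial e \<in> homogeneous_polys d \<longleftrightarrow> (\<Sum>v\<in>UNIV. poly_mapping.lookup e v) = d" for e
    by (simp add: homogeneous_polys_def monomial_eq_single)
  ultimately show ?thesis
    unfolding W_def H1_def H2_def H3_def diag_derivation_monomial eig
    by (simp only: conv1 conv2 conv3)
qed

end

theory Submission
  imports Defs
begin

text \<open>
  Distinct monomials are linearly independent, so \<open>dim W(d;a,b,c)\<close> is the number of exponent arrays
  of weight \<open>(a,b,c)\<close> and total \<open>d\<close> (\<open>dim_W_eq_card\<close>). If \<open>d\<close> is odd and \<open>a\<close> is even there are
  none, since the total and the first weight have the same parity. So let \<open>d = 2n\<close> and let the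
  weights be \<open>2x\<close>, \<open>2y\<close>, \<open>2z\<close>.

  Each weight operator acts with opposite signs on the variables of two antipodal vertices of the
  cube, so the three weight equations only see the differences
  \<open>p = e000 - e111\<close>, \<open>q = e001 - e110\<close>, \<open>r = e010 - e101\<close>, \<open>s = e011 - e100\<close>; they read
  \<open>p + q + r + s = 2x\<close>, \<open>p + q - r - s = 2y\<close>, \<open>p - q + r - s = 2z\<close>. Their solutions form a line:
  \<open>p = t\<close>, \<open>q = x + y - t\<close>, \<open>r = x + z - t\<close>, \<open>s = t - y - z\<close>. Given the differences, the array is
  determined by the minima of the four antipodal pairs, which are arbitrary natural numbers except
  that twice their sum is \<open>2n - S(t)\<close>, where \<open>S(t) = |p| + |q| + |r| + |s|\<close>
  (\<open>bij_betw_weight_arrays\<close>). Hence, with binomials read as \<open>0\<close> when \<open>n < S(t)/2\<close>,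
  \[ \dim W(2n;2x,2y,2z) = \sum_t \binom{n - S(t)/2 + 3}{3}. \]

  For the weights of the theorem, \<open>S(t)/2\<close> runs through an arithmetic progression of difference 2
  for \<open>t = 0, -1, -2, ...\<close>, and through another one for \<open>t = 2, 3, 4, ...\<close>. So the sum is
  a single term at \<open>t = 1\<close> plus two sums of binomials over arithmetic progressions of difference 2,
  and the latter telescope to a quasi-polynomial
  (\<open>sum_card_quadruples\<close>). The period 4 in \<open>d\<close> is the parity of \<open>n\<close>.
\<close>

section \<open>Dimensions as array counts\<close>

lemma inj_monomial: "inj monomial"
  by (rule injI) (metis lookup_single_eq lookup_single_not_eq monomial_eq_single zero_neq_one)

text \<open>Reading off the coefficient at \<open>e\<close> isolates the scalar in front of \<open>monomial e\<close>.\<close>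

lemma independent_range_monomial: "cpoly.independent (range monomial)"
  unfolding cpoly.independent_explicit_module
proof (intro allI impI)
  fix T u m
  assume "finite T" "T \<subseteq> range monomial" and zero: "(\<Sum>v\<in>T. scale (u v) v) = 0" and "m \<in> T"
  then obtain e where e: "m = monomial e" by auto
  have coeff: "poly_mapping.lookup (scale (u v) v) e = (if v = m then u v else 0)" if "v \<in> T" for v
  proof -
    obtain f where f: "v = monomial f" using \<open>v \<in> T\<close> \<open>T \<subseteq> range monomial\<close> by auto
    have "v = m \<longleftrightarrow> f = e" using inj_monomial by (simp add: f e inj_eq)
    then show ?thesis by (auto simp: f lookup_scale monomial_eq_single lookup_single when_def)
  qed
  have "0 = poly_mapping.lookup (\<Sum>v\<in>T. scale (u v) v) e" by (simp add: zero)
  also have "\<dots> = u m" using \<open>finite T\<close> \<open>m \<in> T\<close> by (simp add: lookup_sum coeff)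
  finally show "u m = 0" by simp
qed

lemma dim_span_monomials: "cpoly.dim (cpoly.span (monomial ` E)) = card E"
proof -
  have "cpoly.independent (monomial ` E)"
    by (rule cpoly.independent_mono[OF independent_range_monomial]) auto
  then show ?thesis
    by (simp add: cpoly.dim_span_eq_card_independent card_image inj_on_subset[OF inj_monomial]
        del: cpoly.dim_span)
qed

text \<open>The summands are ordered so that antipodal vertices of the cube are adjacent.\<close>

lemma sum_idx:
  "(\<Sum>v\<in>(UNIV :: idx set). f v) =
     f (False, False, False) + f (True, True, True) + f (False, False, True) + f (True, True, False)
     + f (False, True, False) + f (True, False, True) + f (False, True, True) + f (True, False, False)"
  for f :: "idx \<Rightarrow> 'a :: comm_monoid_add"
proof -
  have U: "(UNIV :: idx set) =
    {(False, False, False), (True, True, True), (False, False, True), (True, True, False),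
     (False, True, False), (True, False, True), (False, True, True), (True, False, False)}"
    by auto
  show ?thesis unfolding U by (simp add: add_ac)
qed

abbreviation entry :: "expo \<Rightarrow> bool \<Rightarrow> bool \<Rightarrow> bool \<Rightarrow> int" where
  "entry e i j k \<equiv> int (poly_mapping.lookup e (i, j, k))"

definition weight_arrays :: "nat \<Rightarrow> nat \<Rightarrow> nat \<Rightarrow> nat \<Rightarrow> expo set" where
  "weight_arrays d a b c = {e.
      (\<Sum>v\<in>UNIV. poly_mapping.lookup e v) = d \<and>
      (\<Sum>(i, j, k)\<in>UNIV. (-1) ^ of_bool i * entry e i j k) = int a \<and>
      (\<Sum>(i, j, k)\<in>UNIV. (-1) ^ of_bool j * entry e i j k) = int b \<and>
      (\<Sum>(i, j, k)\<in>UNIV. (-1) ^ of_bool k * entry e i j k) = int c}"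

lemma dim_W_eq_card: "cpoly.dim (W d a b c) = card (weight_arrays d a b c)"
  unfolding W_explicit weight_arrays_def by (rule dim_span_monomials)

text \<open>
  The total minus the first weight is twice the sum of the entries with first index 1.
\<close>

lemma weight_arrays_odd:
  assumes "odd d" "even a"
  shows "weight_arrays d a b c = {}"
proof -
  have False if "e \<in> weight_arrays d a b c" for e
  proof -
    from that have "int (\<Sum>v\<in>UNIV. poly_mapping.lookup e v) = int d"
      and "(\<Sum>(i, j, k)\<in>UNIV. (-1) ^ of_bool i * entry e i j k) = int a"
      by (simp_all add: weight_arrays_def)
    then have "int d - int a = 2 * (entry e True True True + entry e True True False
        + entry e True False True + entry e True False False)"
      unfolding sum_idx by simp
    then have "even (int d - int a)" by simp
    with assms show False by simp
  qed
  then show ?thesis by blast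
qed

section \<open>Slicing by the difference of one antipodal pair\<close>

text \<open>
  The sum of the absolute differences in the four antipodal pairs, on the slice where
  \<open>e000 - e111 = t\<close>. This is the least total of an array of weight \<open>(2x, 2y, 2z)\<close>
  in that slice.
\<close>

definition spread :: "nat \<Rightarrow> nat \<Rightarrow> nat \<Rightarrow> int \<Rightarrow> int" where
  "spread x y z t = \<bar>t\<bar> + \<bar>int x + int y - t\<bar> + \<bar>int x + int z - t\<bar> + \<bar>t - int y - int z\<bar>"

text \<open>
  The argument is an integer, so that slices whose spread exceeds the total get the empty set. Lists
  stand for 4-tuples, to fit the stars-and-bars formula for lists.
\<close>

definition quadruples :: "int \<Rightarrow> nat list set" where
  "quadruples m = {l. length l = 4 \<and> int (sum_list l) = m}"

lemma even_spread: "even (spread x y z t)"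
  by (cases "even t"; cases "even x"; cases "even y"; cases "even z"; simp add: spread_def)

text \<open>
  The weight equations solved for the differences of the other three antipodal pairs in terms of
  the difference \<open>t = e000 - e111\<close>. Total and weights
  are written as doubles so that the solution has no fractions.
\<close>

lemma mem_weight_arrays_even:
  "e \<in> weight_arrays (2 * n) (2 * x) (2 * y) (2 * z) \<longleftrightarrow>
    int x + int y - (entry e False False False - entry e True True True)
      = entry e False False True - entry e True True False \<and>
    int x + int z - (entry e False False False - entry e True True True)
      = entry e False True False - entry e True False True \<and>
    (entry e False False False - entry e True True True) - int y - int z
      = entry e False True True - entry e True False False \<and>
    entry e False False False + entry e True True True + entry e False False True
     + entry e True True False + entry e False True False + entry e True False True
     + entry e False True True + entry e True False False = 2 * int n"
proof -
  have total: "(\<Sum>v\<in>UNIV. poly_mapping.lookup e v) = 2 * n \<longleftrightarrow>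
      int (\<Sum>v\<in>UNIV. poly_mapping.lookup e v) = 2 * int n" by linarith
  show ?thesis
    unfolding weight_arrays_def mem_Collect_eq total sum_idx of_nat_add
    by (simp; intro iffI conjI; elim conjE; linarith)
qed

text \<open>
  The array whose four antipodal pairs have differences \<open>p\<close>, \<open>q\<close>, \<open>r\<close>, \<open>s\<close> and minima listed
  in \<open>l\<close>: of \<open>nat p\<close> and \<open>nat (- p)\<close>, one is \<open>\<bar>p\<bar>\<close> and the other is 0.
\<close>

fun array_entry :: "int \<Rightarrow> int \<Rightarrow> int \<Rightarrow> int \<Rightarrow> nat list \<Rightarrow> idx \<Rightarrow> nat" where
  "array_entry p q r s l (False, False, False) = l ! 0 + nat p"
| "array_entry p q r s l (True,  True,  True)  = l ! 0 + nat (- p)"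
| "array_entry p q r s l (False, False, True)  = l ! 1 + nat q"
| "array_entry p q r s l (True,  True,  False) = l ! 1 + nat (- q)"
| "array_entry p q r s l (False, True,  False) = l ! 2 + nat r"
| "array_entry p q r s l (True,  False, True)  = l ! 2 + nat (- r)"
| "array_entry p q r s l (False, True,  True)  = l ! 3 + nat s"
| "array_entry p q r s l (True,  False, False) = l ! 3 + nat (- s)"

lemma mem_quadruples_iff:
  "l \<in> quadruples m \<longleftrightarrow>
    (\<exists>k1 k2 k3 k4. l = [k1, k2, k3, k4] \<and> int k1 + int k2 + int k3 + int k4 = m)"
  by (auto simp: quadruples_def numeral_eq_Suc length_Suc_conv)

lemma all_idx:
  "(\<forall>v :: idx. P v) \<longleftrightarrow>
     P (False, False, False) \<and> P (True, True, True) \<and> P (False, False, True) \<and> P (True, True, False)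
     \<and> P (False, True, False) \<and> P (True, False, True) \<and> P (False, True, True) \<and> P (True, False, False)"
  by (simp add: all_bool_eq) blast

lemma lookup_Abs_expo: "poly_mapping.lookup (Abs_poly_mapping f :: expo) = f"
  by simp

lemma nth_quadruple:
  "[k1, k2, k3, k4] ! 0 = k1" "[k1, k2, k3, k4] ! 1 = k2"
  "[k1, k2, k3, k4] ! 2 = k3" "[k1, k2, k3, k4] ! 3 = k4"
  by simp_all

lemma split_pair:
  "int (k + nat i) - int (k + nat (- i)) = i"
  "min (k + nat i) (k + nat (- i)) = k"
  "int (k + nat i) + int (k + nat (- i)) = 2 * int k + \<bar>i\<bar>"
  by simp_all

lemma join_pair:
  "min m n + nat (int m - int n) = m"
  "min m n + nat (- (int m - int n)) = n"
  by simp_all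

text \<open>
  The inverse map sends an array to the difference of its first antipodal pair together with the
  minima of all four pairs. Every \<open>K\<close> from the total on works as cutoff for \<open>t\<close>, because an array
  with total \<open>2 * n\<close> has \<open>\<bar>e000 - e111\<bar> \<le> 2 * n\<close>; the asymmetric interval is the one that
  is convenient to split at \<open>t = 1\<close>.
\<close>

lemma bij_betw_weight_arrays:
  assumes K: "2 * n \<le> K"
  shows "bij_betw (\<lambda>(t, l). Abs_poly_mapping
        (array_entry t (int x + int y - t) (int x + int z - t) (t - int y - int z) l))
      (SIGMA t : {- int K..int K + 1}. quadruples (int n - spread x y z t div 2))
      (weight_arrays (2 * n) (2 * x) (2 * y) (2 * z))"
    (is "bij_betw ?\<psi> ?S ?A")
proof (rule bij_betw_byWitness)
  let ?m = "\<lambda>e i j k. min (poly_mapping.lookup e (i, j, k)) (poly_mapping.lookup e (\<not> i, \<not> j, \<not> k))"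
  let ?\<phi> = "\<lambda>e. (entry e False False False - entry e True True True,
      [?m e False False False, ?m e False False True, ?m e False True False, ?m e False True True])"
  note array_simps = lookup_Abs_expo array_entry.simps prod.case nth_quadruple
    not_False_eq_True not_True_eq_False
  show "\<forall>tl\<in>?S. ?\<phi> (?\<psi> tl) = tl"
  proof (clarify, goal_cases)
    case (1 t l)
    then obtain k1 k2 k3 k4 where l: "l = [k1, k2, k3, k4]" by (auto simp: mem_quadruples_iff)
    show ?case unfolding l array_simps split_pair by (intro conjI refl)
  qed
  show "\<forall>e\<in>?A. ?\<psi> (?\<phi> e) = e"
  proof
    fix e assume "e \<in> ?A"
    let ?t = "entry e False False False - entry e True True True"
    from \<open>e \<in> ?A\<close> have rests:
      "int x + int y - ?t = entry e False False True - entry e True True False"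
      "int x + int z - ?t = entry e False True False - entry e True False True"
      "?t - int y - int z = entry e False True True - entry e True False False"
      unfolding mem_weight_arrays_even by blast+
    have "\<forall>v. poly_mapping.lookup (?\<psi> (?\<phi> e)) v = poly_mapping.lookup e v"
      unfolding all_idx array_simps rests join_pair by (intro conjI refl)
    then show "?\<psi> (?\<phi> e) = e" by (intro poly_mapping_eqI) blast
  qed
  show "?\<psi> ` ?S \<subseteq> ?A"
  proof (clarify, goal_cases)
    case (1 _ t l)
    then obtain k1 k2 k3 k4 where l: "l = [k1, k2, k3, k4]"
      and k: "int k1 + int k2 + int k3 + int k4 = int n - spread x y z t div 2"
      by (auto simp: mem_quadruples_iff)
    have "2 * (int k1 + int k2 + int k3 + int k4) + spread x y z t = 2 * int n"
      using k even_spread[of x y z t] by auto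
    then show ?case
      unfolding spread_def mem_weight_arrays_even l array_simps split_pair
      using split_pair(3)[of k1 t] split_pair(3)[of k2 "int x + int y - t"]
        split_pair(3)[of k3 "int x + int z - t"] split_pair(3)[of k4 "t - int y - int z"]
      by auto
  qed
  show "?\<phi> ` ?A \<subseteq> ?S"
  proof (rule image_subsetI)
    fix e assume e: "e \<in> ?A"
    define t where "t = entry e False False False - entry e True True True"
    from e have rests:
      "int x + int y - t = entry e False False True - entry e True True False"
      "int x + int z - t = entry e False True False - entry e True False True"
      "t - int y - int z = entry e False True True - entry e True False False"
      unfolding mem_weight_arrays_even t_def by blast+
    have min2: "2 * int (min i j) = int i + int j - \<bar>int i - int j\<bar>" for i j by simp
    have "2 * (int (?m e False False False) + int (?m e False False True)
       + int (?m e False True False) + int (?m e False True True)) = 2 * int n - spread x y z t"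
      using e unfolding mem_weight_arrays_even spread_def rests distrib_left min2
      by (simp add: t_def)
    moreover have "- int K \<le> t" "t \<le> int K"
      using e K unfolding mem_weight_arrays_even t_def by linarith+
    ultimately show "?\<phi> e \<in> ?S"
      using even_spread[of x y z t]
      by (auto simp: mem_quadruples_iff t_def[symmetric])
  qed
qed

section \<open>Summing the slices\<close>

text \<open>
  Stars and bars give \<open>(m + 3) choose 3\<close> for \<open>m \<ge> 0\<close>; the roots of the cubic polynomial extend the
  formula to the empty cases \<open>m = -1, -2, -3\<close>. This margin absorbs the small offsets that appear
  when \<open>n\<close> is close to 0.
\<close>

lemma card_quadruples:
  assumes "-3 \<le> m"
  shows "real (card (quadruples m)) = (of_int m + 1) * (of_int m + 2) * (of_int m + 3) / 6"
proof (cases "m < 0")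
  case True
  then have "quadruples m = {}" by (auto simp: quadruples_def)
  moreover have "m \<in> {-3, -2, -1}" using assms True by auto
  ultimately show ?thesis by auto
next
  case False
  then obtain k where k: "m = int k" using nonneg_int_cases[of m] by auto
  have "card (quadruples m) = (k + 3) choose 3"
    using card_length_sum_list[of 4 k] binomial_symmetric[of k "k + 3"]
    by (simp add: quadruples_def k add.commute)
  also have "real \<dots> = (of_nat k + 3) gchoose 3" by (simp add: binomial_gbinomial)
  finally show ?thesis
    by (simp add: k gbinomial_prod_rev numeral_3_eq_3 fact_numeral algebra_simps)
qed

text \<open>
  The solution of \<open>f m - f (m - 2) = (m + 1) * (m + 2) * (m + 3) / 6\<close> that vanishes for both
  \<open>m = -1\<close> and \<open>m = -2\<close>. Its expression in \<open>m + 3\<close> is even, so it also vanishes at \<open>m = -4, -5\<close>,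
  and at the double root \<open>m = -3\<close>.
\<close>

definition quad_sum :: "int \<Rightarrow> real" where
  "quad_sum m = ((of_int m + 3)^4 - 4 * (of_int m + 3)^2 + (if even m then 3 else 0)) / 48"

text \<open>
  The sum telescopes: the terms with \<open>m - 2 * j < 0\<close> are 0, and \<open>quad_sum\<close> vanishes at the first
  negative index. At \<open>m = -6\<close> the closed form would be 1, whence the lower bound.
\<close>

lemma sum_card_quadruples:
  assumes "-5 \<le> m" "m < 2 * int K"
  shows "(\<Sum>j<K. real (card (quadruples (m - 2 * int j)))) = quad_sum m"
  using assms
proof (induction K arbitrary: m)
  case 0
  then have "m \<in> {-5, -4, -3, -2, -1}" by auto
  then show ?case by (auto simp: quad_sum_def)
next
  case (Suc K)
  show ?case
  proof (cases "m < 0")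
    case True
    then have "quadruples (m - 2 * int j) = {}" for j by (auto simp: quadruples_def)
    moreover have "m \<in> {-5, -4, -3, -2, -1}" using Suc.prems True by auto
    ultimately show ?thesis by (auto simp: quad_sum_def)
  next
    case False
    have "(\<Sum>j<Suc K. real (card (quadruples (m - 2 * int j)))) =
        real (card (quadruples m)) + (\<Sum>j<K. real (card (quadruples (m - 2 - 2 * int j))))"
      unfolding sum.lessThan_Suc_shift by (simp add: algebra_simps)
    also have "\<dots> = (of_int m + 1) * (of_int m + 2) * (of_int m + 3) / 6 + quad_sum (m - 2)"
      using False Suc.prems Suc.IH[of "m - 2"] by (simp add: card_quadruples)
    also have "\<dots> = quad_sum m"
      by (simp add: quad_sum_def field_simps) algebra
    finally show ?thesis .
  qed
qed

lemma sum_split_at_1: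
  "(\<Sum>t\<in>{- int K..int K + 1}. f t) =
     (\<Sum>j<Suc K. f (- int j)) + f 1 + (\<Sum>j<K. f (2 + int j))"
  for f :: "int \<Rightarrow> 'a :: ab_group_add"
proof (induction K)
  case 0
  have "{0..1::int} = {0, 1}" by auto
  then show ?case by simp
next
  case (Suc K)
  have "{- int (Suc K)..int (Suc K) + 1} =
      insert (- int (Suc K)) (insert (2 + int K) {- int K..int K + 1})" by auto
  then show ?case using Suc.IH by (simp add: algebra_simps)
qed

text \<open>
  The hypotheses say that the spread is linear with slope 4 on each side of \<open>t = 1\<close>, so that half of
  it runs through an arithmetic progression of difference 2. The point \<open>t = 1\<close> is kept apart: there
  the spread need not fit either progression. The bounds on \<open>u\<close>, \<open>v\<close>, \<open>w\<close> keep the closed forms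
  valid down to \<open>n = 0\<close>.
\<close>

lemma dim_W_even:
  assumes le: "\<And>j. spread x y z (- int j) = 2 * int u + 4 * int j"
    and one: "spread x y z 1 = 2 * int v"
    and ge: "\<And>j. spread x y z (2 + int j) = 2 * int w + 4 * int j"
    and bounds: "u \<le> 5" "v \<le> 3" "w \<le> 5"
  shows "real (cpoly.dim (W (2 * n) (2 * x) (2 * y) (2 * z))) =
    quad_sum (int n - int u) + (real n - v + 1) * (real n - v + 2) * (real n - v + 3) / 6
    + quad_sum (int n - int w)"
proof -
  \<comment> \<open>Beyond the cutoff \<open>2 * n\<close> for \<open>t\<close>, so that \<open>n < 2 * K\<close> also holds for \<open>n = 0\<close>.\<close>
  define K where "K = 2 * n + 1"
  let ?f = "\<lambda>t. real (card (quadruples (int n - spread x y z t div 2)))"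
  have le_half: "spread x y z (- int j) div 2 = int u + 2 * int j" for j by (subst le) simp
  have ge_half: "spread x y z (2 + int j) div 2 = int w + 2 * int j" for j by (subst ge) simp
  have fin: "finite (quadruples m)" for m
  proof -
    have "quadruples m \<subseteq> {l. set l \<subseteq> {..nat m} \<and> length l = 4}"
      using member_le_sum_list by (fastforce simp: quadruples_def)
    then show ?thesis by (rule finite_subset) (simp add: finite_lists_length_eq)
  qed
  have "cpoly.dim (W (2 * n) (2 * x) (2 * y) (2 * z)) =
      card (SIGMA t : {- int K..int K + 1}. quadruples (int n - spread x y z t div 2))"
    unfolding dim_W_eq_card
    by (rule bij_betw_same_card[symmetric, OF bij_betw_weight_arrays]) (simp add: K_def)
  then have "real (cpoly.dim (W (2 * n) (2 * x) (2 * y) (2 * z))) =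
      (\<Sum>t\<in>{- int K..int K + 1}. ?f t)"
    using fin by simp
  also have "\<dots> = (\<Sum>j<Suc K. ?f (- int j)) + ?f 1 + (\<Sum>j<K. ?f (2 + int j))"
    by (rule sum_split_at_1)
  also have "(\<Sum>j<Suc K. ?f (- int j)) =
      (\<Sum>j<Suc K. real (card (quadruples (int n - int u - 2 * int j))))"
    by (simp only: le_half diff_diff_eq)
  also have "\<dots> = quad_sum (int n - int u)"
    by (rule sum_card_quadruples) (use bounds in \<open>auto simp: K_def\<close>)
  also have "(\<Sum>j<K. ?f (2 + int j)) =
      (\<Sum>j<K. real (card (quadruples (int n - int w - 2 * int j))))"
    by (simp only: ge_half diff_diff_eq)
  also have "\<dots> = quad_sum (int n - int w)"
    by (rule sum_card_quadruples) (use bounds in \<open>auto simp: K_def\<close>)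
  also have "?f 1 = (real n - v + 1) * (real n - v + 2) * (real n - v + 3) / 6"
    using bounds by (simp add: one card_quadruples)
  finally show ?thesis .
qed

theorem theorem31:
  fixes d :: nat
  shows
    "((d mod 4 = 0 \<longrightarrow> real (cpoly.dim (W d 0 0 0)) =
        1/384 * (real d + 4)^2 * ((real d)^2 + 8 * real d + 24)) \<and>
      (d mod 4 = 2 \<longrightarrow> real (cpoly.dim (W d 0 0 0)) =
        1/384 * (real d + 2) * (real d + 6) * ((real d)^2 + 8 * real d + 28)) \<and>
      (odd d \<longrightarrow> cpoly.dim (W d 0 0 0) = 0))
     \<and>
     (\<forall>(a, b, c) \<in> {(2, 0, 0), (0, 2, 0), (0, 0, 2)}.
      (d mod 4 = 0 \<longrightarrow> real (cpoly.dim (W d a b c)) =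
        1/384 * real d * (real d + 4)^2 * (real d + 8)) \<and>
      (d mod 4 = 2 \<longrightarrow> real (cpoly.dim (W d a b c)) =
        1/384 * (real d + 2) * (real d + 6) * ((real d)^2 + 8 * real d + 4)) \<and>
      (odd d \<longrightarrow> cpoly.dim (W d a b c) = 0))
     \<and>
     (\<forall>(a, b, c) \<in> {(2, 2, 0), (2, 0, 2), (0, 2, 2)}.
      (d mod 4 = 0 \<longrightarrow> real (cpoly.dim (W d a b c)) =
        1/384 * real d * (real d + 4) * ((real d)^2 + 12 * real d + 8)) \<and>
      (d mod 4 = 2 \<longrightarrow> real (cpoly.dim (W d a b c)) =
        1/384 * (real d + 2) * ((real d)^3 + 14 * (real d)^2 + 28 * real d - 24)) \<and>
      (odd d \<longrightarrow> cpoly.dim (W d a b c) = 0))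
     \<and>
     ((d mod 4 = 0 \<longrightarrow> real (cpoly.dim (W d 2 2 2)) =
        1/384 * real d * ((real d)^3 + 16 * (real d)^2 + 32 * real d + 32)) \<and>
      (d mod 4 = 2 \<longrightarrow> real (cpoly.dim (W d 2 2 2)) =
        1/384 * (real d + 2) * ((real d)^3 + 14 * (real d)^2 + 4 * real d + 24)) \<and>
      (odd d \<longrightarrow> cpoly.dim (W d 2 2 2) = 0))"

proof (cases "odd d")
  case True
  then have "d mod 4 \<noteq> 0" "d mod 4 \<noteq> 2" by presburger+
  with True show ?thesis by (simp add: dim_W_eq_card weight_arrays_odd)
next
  case False
  then obtain n where d: "d = 2 * n" by blast
  have mod4: "d mod 4 = 0 \<longleftrightarrow> even n" "d mod 4 = 2 \<longleftrightarrow> odd n"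
    unfolding d by presburger+
  have mod4: "d mod 4 = 0 \<longleftrightarrow> even n" "d mod 4 = 2 \<longleftrightarrow> odd n"
    unfolding d by presburger+
  have real_d: "real d = 2 * real n" by (simp add: d)
  \<comment> \<open>The parity term of \<open>quad_sum n\<close>; at arguments of the other parity it becomes \<open>3 - c\<close>.\<close>
  define c where "c = (if even n then 3 else 0 :: real)"
  have c: "even n \<Longrightarrow> c = 3" "odd n \<Longrightarrow> c = 0" by (simp_all add: c_def)
  let ?N = "real n"
  \<comment> \<open>The last three numerals given to \<open>dim_W_even\<close> are half the spread at \<open>t = 0, 1, 2\<close>.\<close>
  have W000: "real (cpoly.dim (W d 0 0 0)) = ((?N+3)^4 - 4*(?N+3)^2 + c)/48 +
        (?N-1)*?N*(1 + ?N)/6 +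
        ((?N-1)^4 - 4*(?N-1)^2 + c)/48"
    using dim_W_even[of 0 0 0 0 2 4 n] by (simp add: spread_def quad_sum_def d c_def)
  have W200: "\<forall>(a, b, c') \<in> {(2, 0, 0), (0, 2, 0), (0, 0, 2)}.
      real (cpoly.dim (W d a b c')) = ((2 + ?N)^4 - 4*(2 + ?N)^2 + (3 - c))/48 +
        ?N*(1 + ?N)*(2 + ?N)/6 +
        (?N^4 - 4*?N^2 + (3 - c))/48"
    using dim_W_even[of 1 0 0 1 1 3 n] dim_W_even[of 0 1 0 1 1 3 n] dim_W_even[of 0 0 1 1 1 3 n]
    by (simp add: spread_def quad_sum_def d c_def)
  have W220: "\<forall>(a, b, c') \<in> {(2, 2, 0), (2, 0, 2), (0, 2, 2)}.
      real (cpoly.dim (W d a b c')) = ((1 + ?N)^4 - 4*(1 + ?N)^2 + c)/48 +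
        ?N*(1 + ?N)*(2 + ?N)/6 +
        ((1 + ?N)^4 - 4*(1 + ?N)^2 + c)/48"
    using dim_W_even[of 1 1 0 2 1 2 n] dim_W_even[of 1 0 1 2 1 2 n] dim_W_even[of 0 1 1 2 1 2 n]
    by (simp add: spread_def quad_sum_def d c_def)
  have W222: "real (cpoly.dim (W d 2 2 2)) = (?N^4 - 4*?N^2 + (3 - c))/48 +
        (?N-1)*?N*(1 + ?N)/6 +
        ((2 + ?N)^4 - 4*(2 + ?N)^2 + (3 - c))/48"
    using dim_W_even[of 1 1 1 3 2 1 n] by (simp add: spread_def quad_sum_def d c_def)
  show ?thesis
    unfolding mod4 real_d
    using W000 W200 W220 W222 False
    by (auto simp: c power_mult_distrib)
      (simp_all add: field_simps power2_eq_square power3_eq_cube power4_eq_xxxx)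
qed

end
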